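(* Let $G,H$ be finite directed graphs and $\xi=(\xi^0,\xi^1)$ a pair of graph embeddings $H\to G$ satisfying the standing hypotheses. Then the connected subsets of $X_\xi^+$ are either points or circles, and both occur.
   Context: **Graphs.** A finite directed graph $G$ consists of finite sets $G^0$ (vertices), $G^1$ (edges) and maps $i,t:G^1\to G^0$ (initial and terminal vertex). $G$ is primitive if there is $k\ge1$ such that for all $v,w\in G^0$ there is a path of length $k$ from $v$ to $w$. $X_G^+$ is the set of sequences $x=(x_n)_{n\ge1}$ in $G^1$ with $t(x_n)=i(x_{n+1})$ for all $n$, with the topology given by the metric $d_G(x,y)=\inf\{2^{-n}: n\ge0,\ x_j=y_j \text{ for }1\le j\le n\}$. A graph embedding $H\to G$ is an injective map sending $H^0$ into $G^0$ and $H^1$ into $G^1$ and commuting with $i$ and $t$. **Standing hypotheses** on $(G,H,\xi^0,\xi^1)$: $G$ is primitive; $\xi^0|_{H^0}=\xi^1|_{H^0}$; $\xi^0(H^1)\cap\xi^1(H^1)=\emptyset$; for every $y\in H^1$ there is $x\in G^1\setminus(\xi^0(H^1)\cup\xi^1(H^1))$ with $i(x)=i(\xi^0(y))$, $t(x)=t(\xi^0(y))$. Write $\xi(H^1)=\xi^0(H^1)\cup\xi^1(H^1)$. **The relation $\sim_\xi$ on $X_G^+$.** $x\sim_\xi x$ for all $x$; and $x\sim_\xi x'$ if either (1) for some $n\ge1$, $j\in\{0,1\}$, $y_n,y_{n+1},\ldots\in H^1$: $x=(x_1,\dots,x_{n-1},\xi^{1-j}(y_n),\xi^j(y_{n+1}),\xi^j(y_{n+2}),\dots)$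 and $x'=(x_1,\dots,x_{n-1},\xi^{j}(y_n),\xi^{1-j}(y_{n+1}),\xi^{1-j}(y_{n+2}),\dots)$; or (2) for some $n\ge0$, $j\in\{0,1\}$, $y_{n+1},y_{n+2},\ldots\in H^1$, where $n=0$ or $x_n\notin\xi(H^1)$: $x=(x_1,\dots,x_n,\xi^j(y_{n+1}),\xi^j(y_{n+2}),\dots)$ and $x'=(x_1,\dots,x_n,\xi^{1-j}(y_{n+1}),\xi^{1-j}(y_{n+2}),\dots)$. This is an equivalence relation, and $X_\xi^+=X_G^+/\sim_\xi$ with the quotient topology.
   Formalization: "Connected subsets" is read as connected components (proper arcs of a circle are connected). Occurrence of a point component is claimed only if G has a vertex, and of a circle only if H has an infinite path; otherwise these occurrence claims are false. *)

theory Defs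
  imports "HOL-Analysis.Analysis" "Graph_Theory.Arc_Walk"
begin

text \<open>
  Directed graphs are those of \<^theory>\<open>Graph_Theory.Digraph\<close>: vertices \<^const>\<open>verts\<close>,
  edges \<^const>\<open>arcs\<close>, initial vertex \<^const>\<open>tail\<close>, terminal vertex \<^const>\<open>head\<close>.
  The locale \<^locale>\<open>fin_digraph\<close> admits loops and multiple edges, and also the null graph.
\<close>

definition primitive_digraph :: "('v, 'e) pre_digraph \<Rightarrow> bool" where
  "primitive_digraph G \<longleftrightarrow>
     (\<exists>k\<ge>1. \<forall>v\<in>verts G. \<forall>w\<in>verts G. \<exists>p. pre_digraph.awalk G v p w \<and> length p = k)"

record ('v, 'e, 'a, 'b) graph_map =
  vmap :: "'v \<Rightarrow> 'a"
  emap :: "'e \<Rightarrow> 'b"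

definition graph_embedding ::
    "('v, 'e) pre_digraph \<Rightarrow> ('a, 'b) pre_digraph \<Rightarrow> ('v, 'e, 'a, 'b) graph_map \<Rightarrow> bool" where
  "graph_embedding H G f \<longleftrightarrow>
     vmap f ` verts H \<subseteq> verts G \<and> inj_on (vmap f) (verts H) \<and>
     emap f ` arcs H \<subseteq> arcs G \<and> inj_on (emap f) (arcs H) \<and>
     (\<forall>y\<in>arcs H. tail G (emap f y) = vmap f (tail H y) \<and>
                 head G (emap f y) = vmap f (head H y))"

text \<open>
  Sequences are indexed from 0, so \<open>x k\<close> stands for the edge usually written $x_{k+1}$.
\<close>

definition path_space :: "('v, 'e) pre_digraph \<Rightarrow> (nat \<Rightarrow> 'e) set" where
  "path_space G = {x. \<forall>n. x n \<in> arcs G \<and> head G (x n) = tail G (x (Suc n))}"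

definition path_dist :: "(nat \<Rightarrow> 'e) \<Rightarrow> (nat \<Rightarrow> 'e) \<Rightarrow> real" where
  "path_dist x y = (INF n\<in>{n. \<forall>j<n. x j = y j}. (1 / 2) ^ n)"

definition path_topology :: "('v, 'e) pre_digraph \<Rightarrow> (nat \<Rightarrow> 'e) topology" where
  "path_topology G = Metric_space.mtopology (path_space G) path_dist"

lemma path_dist_le: "(\<forall>j<n. x j = y j) \<Longrightarrow> path_dist x y \<le> (1 / 2) ^ n"
  unfolding path_dist_def by (rule cINF_lower) (auto intro!: bdd_belowI2[where m = 0])

lemma path_dist_nonneg: "0 \<le> path_dist x y"
  unfolding path_dist_def by (rule cINF_greatest) (auto intro: exI[of _ 0])

lemma path_dist_ge:
  assumes "x m \<noteq> y m"
  shows "(1 / 2) ^ m \<le> path_dist x y"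
  unfolding path_dist_def
proof (rule cINF_greatest)
  show "{n. \<forall>j<n. x j = y j} \<noteq> {}" by (auto intro: exI[of _ 0])
  fix n assume "n \<in> {n. \<forall>j<n. x j = y j}"
  then have "n \<le> m" using assms by (auto simp: not_le[symmetric])
  then show "(1 / 2) ^ m \<le> ((1 / 2) ^ n :: real)" by (intro power_decreasing) auto
qed

lemma path_dist_self: "path_dist x x = 0"
proof (rule antisym)
  have "path_dist x x \<le> (1 / 2) ^ n" for n by (rule path_dist_le) simp
  moreover have "(\<lambda>n. (1 / 2) ^ n :: real) \<longlonglongrightarrow> 0" by (rule LIMSEQ_realpow_zero) auto
  ultimately show "path_dist x x \<le> 0" using LIMSEQ_le_const by blast
qed (rule path_dist_nonneg)

lemma path_dist_ultra: "path_dist x z \<le> max (path_dist x y) (path_dist y z)"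
proof (cases "x = z")
  case True
  then show ?thesis using path_dist_nonneg[of x y] by (simp add: path_dist_self max.coboundedI1)
next
  case False
  then have "\<exists>m. x m \<noteq> z m" by auto
  then obtain m where m: "x m \<noteq> z m" and eq: "\<And>j. j < m \<Longrightarrow> x j = z j"
    using exists_least_iff[of "\<lambda>m. x m \<noteq> z m"] by blast
  have le: "path_dist x z \<le> (1 / 2) ^ m" using eq by (intro path_dist_le) auto
  consider "x m \<noteq> y m" | "y m \<noteq> z m" using m by (cases "x m = y m") auto
  then show ?thesis
  proof cases
    case 1
    then show ?thesis using le path_dist_ge[of x m y] by linarith
  next
    case 2
    then show ?thesis using le path_dist_ge[of y m z] by linarith
  qed
qed

lemma Metric_space_path_dist: "Metric_space M path_dist"
proof
  show "0 \<le> path_dist x y" for x y :: "nat \<Rightarrow> 'a" by (rule path_dist_nonneg)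
  show "path_dist x y = path_dist y x" for x y :: "nat \<Rightarrow> 'a"
    unfolding path_dist_def by (simp add: eq_commute)
  show "path_dist x y = 0 \<longleftrightarrow> x = y" for x y :: "nat \<Rightarrow> 'a"
  proof
    assume 0: "path_dist x y = 0"
    show "x = y"
    proof (rule ext, rule ccontr)
      fix m assume "x m \<noteq> y m"
      then have "(1 / 2) ^ m \<le> path_dist x y" by (rule path_dist_ge)
      moreover have "(0 :: real) < (1 / 2) ^ m" by simp
      ultimately show False using 0 by linarith
    qed
  qed (simp add: path_dist_self)
  show "path_dist x z \<le> path_dist x y + path_dist y z" for x y z :: "nat \<Rightarrow> 'a"
    using path_dist_ultra[of x z y] path_dist_nonneg[of x y] path_dist_nonneg[of y z] by linarith
qed

lemma topspace_path_topology [simp]: "topspace (path_topology G) = path_space G"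
  unfolding path_topology_def by (simp add: Metric_space.topspace_mtopology Metric_space_path_dist)

text \<open>
  The two clauses of \<open>\<sim>\<^sub>\<xi>\<close>. The pair \<open>(a, b)\<close> plays the role of $(\xi^j, \xi^{1-j})$.
  In \<open>glue1\<close> the index \<open>m\<close> is $n - 1$ because sequences start at 0; in \<open>glue2\<close> the
  number \<open>n\<close> of common leading edges is unchanged, and the last of these is \<open>x (n - 1)\<close>.
\<close>

definition glue1 ::
    "('v, 'e) pre_digraph \<Rightarrow> ('v, 'e, 'a, 'b) graph_map \<Rightarrow> ('v, 'e, 'a, 'b) graph_map
     \<Rightarrow> (nat \<Rightarrow> 'b) \<Rightarrow> (nat \<Rightarrow> 'b) \<Rightarrow> bool" where
  "glue1 H a b x x' \<longleftrightarrow>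
     (\<exists>m y. (\<forall>k<m. x k = x' k) \<and> (\<forall>k\<ge>m. y k \<in> arcs H) \<and>
        x m = emap b (y m) \<and> x' m = emap a (y m) \<and>
        (\<forall>k>m. x k = emap a (y k) \<and> x' k = emap b (y k)))"

definition glue2 ::
    "('v, 'e) pre_digraph \<Rightarrow> ('v, 'e, 'a, 'b) graph_map \<Rightarrow> ('v, 'e, 'a, 'b) graph_map
     \<Rightarrow> (nat \<Rightarrow> 'b) \<Rightarrow> (nat \<Rightarrow> 'b) \<Rightarrow> bool" where
  "glue2 H a b x x' \<longleftrightarrow>
     (\<exists>n y. (n = 0 \<or> x (n - 1) \<notin> emap a ` arcs H \<union> emap b ` arcs H) \<and>
        (\<forall>k<n. x k = x' k) \<and>
        (\<forall>k\<ge>n. y k \<in> arcs H \<and> x k = emap a (y k) \<and> x' k = emap b (y k)))"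

definition xi_rel ::
    "('a, 'b) pre_digraph \<Rightarrow> ('v, 'e) pre_digraph \<Rightarrow> ('v, 'e, 'a, 'b) graph_map
     \<Rightarrow> ('v, 'e, 'a, 'b) graph_map \<Rightarrow> ((nat \<Rightarrow> 'b) \<times> (nat \<Rightarrow> 'b)) set" where
  "xi_rel G H \<xi>0 \<xi>1 =
     {(x, x'). x \<in> path_space G \<and> x' \<in> path_space G \<and>
        (x = x' \<or> (\<exists>(a, b)\<in>{(\<xi>0, \<xi>1), (\<xi>1, \<xi>0)}. glue1 H a b x x' \<or> glue2 H a b x x'))}"

lemma glue1_sym:
  assumes "glue1 H a b x x'"
  shows "glue1 H b a x' x"
proof -
  from assms obtain m y where *: "\<forall>k<m. x k = x' k" "\<forall>k\<ge>m. y k \<in> arcs H"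
    "x m = emap b (y m)" "x' m = emap a (y m)"
    "\<forall>k>m. x k = emap a (y k) \<and> x' k = emap b (y k)" unfolding glue1_def by (elim exE conjE)
  show ?thesis
    unfolding glue1_def by (rule exI[of _ m], rule exI[of _ y]) (intro conjI allI impI, simp_all only: *)
qed

lemma glue2_sym:
  assumes "glue2 H a b x x'"
  shows "glue2 H b a x' x"
proof -
  from assms obtain n y
    where n: "n = 0 \<or> x (n - 1) \<notin> emap a ` arcs H \<union> emap b ` arcs H"
      and eq: "\<forall>k<n. x k = x' k"
      and y: "\<forall>k\<ge>n. y k \<in> arcs H \<and> x k = emap a (y k) \<and> x' k = emap b (y k)"
    unfolding glue2_def by (elim exE conjE)
  have "n = 0 \<or> x (n - 1) = x' (n - 1)" using eq by (cases n) auto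
  then have "n = 0 \<or> x' (n - 1) \<notin> emap b ` arcs H \<union> emap a ` arcs H"
    using n by auto
  then show ?thesis
    unfolding glue2_def using eq y
    by (intro exI[of _ n] exI[of _ y] conjI allI impI) simp_all
qed

lemma glue_tail:
  assumes "glue1 H a b x x' \<or> glue2 H a b x x'"
  shows "\<exists>N. \<forall>k\<ge>N. x k \<in> emap a ` arcs H"
  using assms
proof
  assume "glue1 H a b x x'"
  then obtain m y where "\<forall>k\<ge>m. y k \<in> arcs H"
    "\<forall>k>m. x k = emap a (y k) \<and> x' k = emap b (y k)"
    unfolding glue1_def by (elim exE conjE)
  then show ?thesis by (intro exI[of _ "Suc m"]) auto
next
  assume "glue2 H a b x x'"
  then obtain n y where "\<forall>k\<ge>n. y k \<in> arcs H \<and> x k = emap a (y k) \<and> x' k = emap b (y k)"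
    unfolding glue2_def by (elim exE conjE)
  then show ?thesis by (intro exI[of _ n]) auto
qed

lemma glue_unique:
  assumes inja: "inj_on (emap a) (arcs H)" and injb: "inj_on (emap b) (arcs H)"
    and disj: "emap a ` arcs H \<inter> emap b ` arcs H = {}"
    and g: "glue1 H a b x x' \<or> glue2 H a b x x'" "glue1 H a b x x'' \<or> glue2 H a b x x''"
  shows "x' = x''"
proof -
  have neq: "emap a u \<noteq> emap b v" if "u \<in> arcs H" "v \<in> arcs H" for u v
    using disj that by (metis disjoint_iff imageI)
  have g11: "x' = x''" if "glue1 H a b x x'" "glue1 H a b x x''" for x' x''
  proof -
    from that(1) obtain m y where 1: "\<forall>k<m. x k = x' k" "\<forall>k\<ge>m. y k \<in> arcs H"
      "x m = emap b (y m)" "x' m = emap a (y m)"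
      "\<forall>k>m. x k = emap a (y k) \<and> x' k = emap b (y k)" unfolding glue1_def by (elim exE conjE)
    from that(2) obtain n z where 2: "\<forall>k<n. x k = x'' k" "\<forall>k\<ge>n. z k \<in> arcs H"
      "x n = emap b (z n)" "x'' n = emap a (z n)"
      "\<forall>k>n. x k = emap a (z k) \<and> x'' k = emap b (z k)" unfolding glue1_def by (elim exE conjE)
    have "\<not> m < n"
    proof
      assume "m < n"
      then have "emap a (y n) = emap b (z n)" using 1(5) 2(3) by simp
      then show False using neq[of "y n" "z n"] 1(2) 2(2) \<open>m < n\<close> by simp
    qed
    moreover have "\<not> n < m"
    proof
      assume "n < m"
      then have "emap a (z m) = emap b (y m)" using 2(5) 1(3) by simp
      then show False using neq[of "z m" "y m"] 1(2) 2(2) \<open>n < m\<close> by simp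
    qed
    ultimately have "m = n" by simp
    show ?thesis
    proof
      fix k
      consider "k < m" | "k = m" | "k > m" by linarith
      then show "x' k = x'' k"
      proof cases
        case 1
        then show ?thesis using \<open>\<forall>k<m. x k = x' k\<close> 2(1) \<open>m = n\<close> by simp
      next
        case 2
        have "y m = z m"
          using inj_onD[OF injb, of "y m" "z m"] 1(2,3) \<open>x n = emap b (z n)\<close>
            \<open>\<forall>k\<ge>n. z k \<in> arcs H\<close> \<open>m = n\<close> by simp
        then show ?thesis using 2 1(4) \<open>x'' n = emap a (z n)\<close> \<open>m = n\<close> by simp
      next
        case 3
        have "y k = z k"
          using inj_onD[OF inja, of "y k" "z k"] 1(2,5) 2(2,5) \<open>m = n\<close> 3 by simp
        then show ?thesis using 3 1(5) 2(5) \<open>m = n\<close> by simp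
      qed
    qed
  qed
  have g12: False if "glue1 H a b x x'" "glue2 H a b x x''" for x' x''
  proof -
    from that(1) obtain m y where 1: "\<forall>k\<ge>m. y k \<in> arcs H"
      "x m = emap b (y m)" "\<forall>k>m. x k = emap a (y k) \<and> x' k = emap b (y k)"
      unfolding glue1_def by (elim exE conjE)
    from that(2) obtain n z where 2: "n = 0 \<or> x (n - 1) \<notin> emap a ` arcs H \<union> emap b ` arcs H"
      "\<forall>k\<ge>n. z k \<in> arcs H \<and> x k = emap a (z k) \<and> x'' k = emap b (z k)"
      unfolding glue2_def by (elim exE conjE)
    show False
    proof (cases "n \<le> m")
      case True
      then have "emap a (z m) = emap b (y m)" using 1(2) 2(2) by simp
      then show False using neq[of "z m" "y m"] 1(1) 2(2) True by simp
    next
      case False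
      then have "n - 1 \<ge> m" "n \<noteq> 0" by auto
      moreover have "x (n - 1) \<in> emap a ` arcs H \<union> emap b ` arcs H"
      proof (cases "n - 1 = m")
        case True
        then show ?thesis using 1(1,2) by simp
      next
        case False
        then have "n - 1 > m" using \<open>n - 1 \<ge> m\<close> by simp
        then show ?thesis using 1(1,3) by simp
      qed
      ultimately show False using 2(1) by simp
    qed
  qed
  have g22: "x' = x''" if "glue2 H a b x x'" "glue2 H a b x x''" for x' x''
  proof -
    from that(1) obtain m y where
      1: "m = 0 \<or> x (m - 1) \<notin> emap a ` arcs H \<union> emap b ` arcs H" "\<forall>k<m. x k = x' k"
      "\<forall>k\<ge>m. y k \<in> arcs H \<and> x k = emap a (y k) \<and> x' k = emap b (y k)"
      unfolding glue2_def by (elim exE conjE)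
    from that(2) obtain n z where
      2: "n = 0 \<or> x (n - 1) \<notin> emap a ` arcs H \<union> emap b ` arcs H" "\<forall>k<n. x k = x'' k"
      "\<forall>k\<ge>n. z k \<in> arcs H \<and> x k = emap a (z k) \<and> x'' k = emap b (z k)"
      unfolding glue2_def by (elim exE conjE)
    have "\<not> m < n"
    proof
      assume "m < n"
      then have "m \<le> n - 1" "n \<noteq> 0" by auto
      then show False using 1(3) 2(1) by auto
    qed
    moreover have "\<not> n < m"
    proof
      assume "n < m"
      then have "n \<le> m - 1" "m \<noteq> 0" by auto
      then show False using 2(3) 1(1) by auto
    qed
    ultimately have "m = n" by auto
    show ?thesis
    proof
      fix k show "x' k = x'' k"
      proof (cases "k < m")
        case False
        then have "y k = z k"
          using 1(3) 2(3) \<open>m = n\<close> inja unfolding inj_on_def by (metis not_less)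
        then show ?thesis using 1(3) 2(3) \<open>m = n\<close> False by auto
      qed (use 1(2) 2(2) \<open>m = n\<close> in auto)
    qed
  qed
  show ?thesis using g g11 g12 g22 by metis
qed

lemma equiv_xi_rel:
  fixes \<xi>0 \<xi>1 :: "('v, 'e, 'a, 'b) graph_map"
  assumes inj: "inj_on (emap \<xi>0) (arcs H)" "inj_on (emap \<xi>1) (arcs H)"
    and disj: "emap \<xi>0 ` arcs H \<inter> emap \<xi>1 ` arcs H = {}"
  shows "equiv (path_space G) (xi_rel G H \<xi>0 \<xi>1)"
proof -
  define g where "g a b x x' \<longleftrightarrow> glue1 H a b x x' \<or> glue2 H a b x x'"
    for a b :: "('v, 'e, 'a, 'b) graph_map" and x x'
  have rel: "(x, x') \<in> xi_rel G H \<xi>0 \<xi>1 \<longleftrightarrow>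
      x \<in> path_space G \<and> x' \<in> path_space G \<and> (x = x' \<or> g \<xi>0 \<xi>1 x x' \<or> g \<xi>1 \<xi>0 x x')" for x x'
    unfolding xi_rel_def g_def by simp
  have g_sym: "g b a x' x" if "g a b x x'" for a b x x'
    using that glue1_sym[of H a b x x'] glue2_sym[of H a b x x'] unfolding g_def by argo
  have uniq0: "x' = x''" if "g \<xi>0 \<xi>1 x x'" "g \<xi>0 \<xi>1 x x''" for x x' x''
    using glue_unique[OF inj disj] that unfolding g_def by metis
  have disj': "emap \<xi>1 ` arcs H \<inter> emap \<xi>0 ` arcs H = {}" using disj by (simp add: Int_commute)
  have uniq1: "x' = x''" if "g \<xi>1 \<xi>0 x x'" "g \<xi>1 \<xi>0 x x''" for x x' x''
    using glue_unique[OF inj(2,1) disj'] that unfolding g_def by metis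
  have excl: False if g01: "g \<xi>0 \<xi>1 x x'" and g10: "g \<xi>1 \<xi>0 x x''" for x x' x''
  proof -
    obtain M where M: "\<forall>k\<ge>M. x k \<in> emap \<xi>0 ` arcs H"
      using glue_tail[OF g01[unfolded g_def]] by (elim exE)
    obtain N where N: "\<forall>k\<ge>N. x k \<in> emap \<xi>1 ` arcs H"
      using glue_tail[OF g10[unfolded g_def]] by (elim exE)
    have "x (max M N) \<in> emap \<xi>0 ` arcs H \<inter> emap \<xi>1 ` arcs H" using M N by simp
    then show False using disj by simp
  qed
  show ?thesis
  proof (rule equivI)
    show "xi_rel G H \<xi>0 \<xi>1 \<subseteq> path_space G \<times> path_space G"
      using rel by auto
    show "refl_on (path_space G) (xi_rel G H \<xi>0 \<xi>1)"
      by (rule refl_onI) (simp add: rel)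
    show "sym (xi_rel G H \<xi>0 \<xi>1)"
      by (rule symI) (metis rel g_sym)
    show "trans (xi_rel G H \<xi>0 \<xi>1)"
      by (rule transI) (metis rel g_sym uniq0 uniq1 excl)
  qed
qed

text \<open>
  The quotient topology on the set of classes of \<open>R\<close>, meant for equivalence relations
  \<open>R\<close> on \<open>topspace X\<close>.
\<close>

definition quotient_topology :: "'c topology \<Rightarrow> ('c \<times> 'c) set \<Rightarrow> 'c set topology" where
  "quotient_topology X R =
     topology (\<lambda>U. U \<subseteq> topspace X // R \<and> openin X {x \<in> topspace X. R `` {x} \<in> U})"

lemma openin_quotient_topology:
  "openin (quotient_topology X R) U \<longleftrightarrow>
     U \<subseteq> topspace X // R \<and> openin X {x \<in> topspace X. R `` {x} \<in> U}"
proof -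
  let ?P = "\<lambda>U. U \<subseteq> topspace X // R \<and> openin X {x \<in> topspace X. R `` {x} \<in> U}"
  have "istopology ?P"
    unfolding istopology_def
  proof (intro conjI allI impI)
    fix S T assume S: "?P S" and T: "?P T"
    show "S \<inter> T \<subseteq> topspace X // R" using S by auto
    have "{x \<in> topspace X. R `` {x} \<in> S \<inter> T} =
        {x \<in> topspace X. R `` {x} \<in> S} \<inter> {x \<in> topspace X. R `` {x} \<in> T}" by auto
    then show "openin X {x \<in> topspace X. R `` {x} \<in> S \<inter> T}"
      using S T by (simp add: openin_Int)
  next
    fix K assume K: "\<forall>U\<in>K. ?P U"
    show "\<Union>K \<subseteq> topspace X // R" using K by auto
    have "{x \<in> topspace X. R `` {x} \<in> \<Union>K} =
        (\<Union>U\<in>K. {x \<in> topspace X. R `` {x} \<in> U})" by auto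
    moreover have "openin X (\<Union>U\<in>K. {x \<in> topspace X. R `` {x} \<in> U})"
      using K by (intro openin_Union) auto
    ultimately show "openin X {x \<in> topspace X. R `` {x} \<in> \<Union>K}" by simp
  qed
  then show ?thesis
    unfolding quotient_topology_def by (simp add: topology_inverse')
qed

lemma topspace_quotient_topology [simp]: "topspace (quotient_topology X R) = topspace X // R"
proof -
  have "{x \<in> topspace X. R `` {x} \<in> topspace X // R} = topspace X"
    by (auto simp: quotient_def)
  then have "openin (quotient_topology X R) (topspace X // R)"
    by (simp add: openin_quotient_topology)
  then show ?thesis
    by (metis openin_quotient_topology openin_subset openin_topspace subset_antisym)
qed

lemma quotient_map_quotient_topology:
  "quotient_map X (quotient_topology X R) (\<lambda>x. R `` {x})"
  unfolding quotient_map_def by (auto simp: openin_quotient_topology quotient_def)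

definition xi_space ::
    "('a, 'b) pre_digraph \<Rightarrow> ('v, 'e) pre_digraph \<Rightarrow> ('v, 'e, 'a, 'b) graph_map
     \<Rightarrow> ('v, 'e, 'a, 'b) graph_map \<Rightarrow> (nat \<Rightarrow> 'b) set topology" where
  "xi_space G H \<xi>0 \<xi>1 = quotient_topology (path_topology G) (xi_rel G H \<xi>0 \<xi>1)"

definition is_point :: "'c set \<Rightarrow> bool" where
  "is_point C \<longleftrightarrow> (\<exists>p. C = {p})"

definition is_circle :: "'c topology \<Rightarrow> 'c set \<Rightarrow> bool" where
  "is_circle X C \<longleftrightarrow> subtopology X C homeomorphic_space top_of_set (sphere (0 :: complex) 1)"

end

theory Submission
  imports Defs
begin

text \<open>
  An edge outside \<open>\<xi>(H\<^sup>1)\<close> at position \<open>k\<close> of \<open>x\<close> freezes all earlier edges of \<open>x\<close>, since two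
  equivalent sequences differ only on a tail contained in \<open>\<xi>(H\<^sup>1)\<close>. Therefore the conditions
  "same edges up to exchanging \<open>\<xi>\<^sup>0(y)\<close> and \<open>\<xi>\<^sup>1(y)\<close>, and same edges before a frozen position",
  imposed on finitely many coordinates, define saturated clopen sets, and the component of \<open>[x]\<close>
  consists of classes of points in their intersection, the strand of \<open>x\<close>. If infinitely many edges
  lie outside \<open>\<xi>(H\<^sup>1)\<close>, the strand is \<open>{x}\<close>. Otherwise it is a fixed prefix followed by all
  sequences of choices between \<open>\<xi>\<^sup>0\<close> and \<open>\<xi>\<^sup>1\<close>, a Cantor set on which \<open>\<sim>\<^sub>\<xi>\<close> identifies exactly
  the pairs of binary expansions of the same point of the circle \<open>\<real> / \<int>\<close>: clause (1) is the
  carry \<open>0111\<dots> = 1000\<dots>\<close> and clause (2) is \<open>0 = 1\<close>.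
\<close>

subsection \<open>Binary expansions of points of the circle\<close>

definition binval :: "(nat \<Rightarrow> bool) \<Rightarrow> real" where
  "binval w = (\<Sum>k. of_bool (w k) * (1 / 2) ^ Suc k)"

text \<open>The two binary expansions of one dyadic rational strictly between 0 and 1:
  \<open>w\<close> ends in 1000..., \<open>w'\<close> in 0111....\<close>

definition carry :: "(nat \<Rightarrow> bool) \<Rightarrow> (nat \<Rightarrow> bool) \<Rightarrow> bool" where
  "carry w w' \<longleftrightarrow> (\<exists>m. (\<forall>k<m. w k = w' k) \<and> w m \<and> \<not> w' m \<and> (\<forall>k>m. \<not> w k \<and> w' k))"

lemma half_powers_sums: "(\<lambda>k. (1 / 2 :: real) ^ Suc k) sums 1"
  using power_half_series by simp

lemma binval_summable: "summable (\<lambda>k. of_bool (w k) * (1 / 2 :: real) ^ Suc k)"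
  by (rule summable_comparison_test'[OF sums_summable[OF half_powers_sums], of 0]) simp

lemma binval_nonneg: "0 \<le> binval w"
  unfolding binval_def by (rule suminf_nonneg[OF binval_summable]) simp

lemma binval_eq_0_iff: "binval w = 0 \<longleftrightarrow> (\<forall>k. \<not> w k)"
  unfolding binval_def by (subst suminf_eq_zero_iff[OF binval_summable]) auto

text \<open>The two series add up digit by digit to the geometric series with sum 1. Upper bounds
  and the value 1 thus reduce to lower bounds and the value 0.\<close>

lemma binval_complement: "binval (\<lambda>k. \<not> w k) = 1 - binval w"
proof -
  have "binval (\<lambda>k. \<not> w k) + binval w = (\<Sum>k. (1 / 2) ^ Suc k)"
    unfolding binval_def suminf_add[OF binval_summable binval_summable]
    by (rule suminf_cong) (simp add: of_bool_def)
  then show ?thesis using sums_unique[OF half_powers_sums] by simp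
qed

lemma binval_le_1: "binval w \<le> 1"
  using binval_nonneg[of "\<lambda>k. \<not> w k"] by (simp add: binval_complement)

lemma binval_eq_1_iff: "binval w = 1 \<longleftrightarrow> (\<forall>k. w k)"
  using binval_eq_0_iff[of "\<lambda>k. \<not> w k"] by (simp add: binval_complement)

lemma binval_split:
  "binval w = (\<Sum>k<n. of_bool (w k) * (1 / 2) ^ Suc k) + (1 / 2) ^ n * binval (\<lambda>k. w (k + n))"
proof -
  have "(1 / 2) ^ n * binval (\<lambda>k. w (k + n)) = (\<Sum>k. of_bool (w (k + n)) * (1 / 2) ^ Suc (k + n))"
    unfolding binval_def suminf_mult[OF binval_summable, symmetric]
    by (rule suminf_cong) (simp add: power_add mult_ac)
  then show ?thesis
    unfolding binval_def suminf_split_initial_segment[OF binval_summable, of w n] by simp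
qed

lemma binval_split_first: "binval w = (of_bool (w 0) + binval (\<lambda>k. w (Suc k))) / 2"
  using binval_split[of w 1] by simp

lemma binval_diff_common_prefix:
  assumes "\<forall>k<n. w k = w' k"
  shows "binval w - binval w' = (1 / 2) ^ n * (binval (\<lambda>k. w (k + n)) - binval (\<lambda>k. w' (k + n)))"
proof -
  have "(\<Sum>k<n. of_bool (w k) * (1 / 2 :: real) ^ Suc k) = (\<Sum>k<n. of_bool (w' k) * (1 / 2) ^ Suc k)"
    using assms by (intro sum.cong) auto
  then show ?thesis
    using binval_split[of w n] binval_split[of w' n] by (simp add: algebra_simps)
qed

lemma binval_dist_le:
  assumes "\<forall>k<n. w k = w' k"
  shows "\<bar>binval w - binval w'\<bar> \<le> (1 / 2) ^ n"
proof -
  have "\<bar>binval (\<lambda>k. w (k + n)) - binval (\<lambda>k. w' (k + n))\<bar> \<le> 1"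
    using binval_nonneg[of "\<lambda>k. w (k + n)"] binval_nonneg[of "\<lambda>k. w' (k + n)"]
      binval_le_1[of "\<lambda>k. w (k + n)"] binval_le_1[of "\<lambda>k. w' (k + n)"] by linarith
  then show ?thesis
    unfolding binval_diff_common_prefix[OF assms] abs_mult by simp
qed

text \<open>With \<open>?u\<close> and \<open>?v\<close> the values of the tails after position
  \<open>m\<close>, the difference is a positive multiple of \<open>1 + ?u - ?v\<close>. As
  \<open>?u\<close> is nonnegative and \<open>?v\<close> at most 1, it vanishes only for an all-zero
  and an all-one tail.\<close>

lemma binval_eq_iff_first_difference:
  assumes "\<forall>k<m. w k = w' k" "w m" "\<not> w' m"
  shows "binval w = binval w' \<longleftrightarrow> (\<forall>k>m. \<not> w k \<and> w' k)"
proof -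
  let ?u = "binval (\<lambda>k. w (Suc k + m))" and ?v = "binval (\<lambda>k. w' (Suc k + m))"
  have "binval w - binval w' = (1 / 2) ^ m * ((1 + ?u) / 2 - ?v / 2)"
    unfolding binval_diff_common_prefix[OF assms(1)]
      binval_split_first[of "\<lambda>k. w (k + m)"] binval_split_first[of "\<lambda>k. w' (k + m)"]
    using assms(2,3) by simp
  then have "binval w = binval w' \<longleftrightarrow> (1 + ?u) / 2 - ?v / 2 = 0"
    by (simp only: eq_iff_diff_eq_0[of "binval w"]) simp
  also have "\<dots> \<longleftrightarrow> ?u = 0 \<and> ?v = 1"
    using binval_nonneg[of "\<lambda>k. w (Suc k + m)"] binval_le_1[of "\<lambda>k. w' (Suc k + m)"] by auto
  also have "\<dots> \<longleftrightarrow> (\<forall>k. \<not> w (Suc k + m) \<and> w' (Suc k + m))"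
    unfolding binval_eq_0_iff binval_eq_1_iff by auto
  also have "\<dots> \<longleftrightarrow> (\<forall>k>m. \<not> w k \<and> w' k)"
    by (metis add.commute less_iff_Suc_add add_Suc_right)
  finally show ?thesis .
qed

lemma binval_eq_iff: "binval w = binval w' \<longleftrightarrow> w = w' \<or> carry w w' \<or> carry w' w"
proof
  assume eq: "binval w = binval w'"
  show "w = w' \<or> carry w w' \<or> carry w' w"
  proof (cases "w = w'")
    case False
    then have "\<exists>m. w m \<noteq> w' m" by auto
    then obtain m where m: "w m \<noteq> w' m" "\<forall>k<m. w k = w' k"
      using exists_least_iff[of "\<lambda>m. w m \<noteq> w' m"] by blast
    show ?thesis
    proof (cases "w m")
      case True
      then show ?thesis
        using m eq binval_eq_iff_first_difference[of m w w'] unfolding carry_def by blast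
    next
      case False
      then show ?thesis
        using m eq binval_eq_iff_first_difference[of m w' w] unfolding carry_def by metis
    qed
  qed simp
next
  have "binval v = binval v'" if "carry v v'" for v v'
    using that binval_eq_iff_first_difference unfolding carry_def by blast
  then show "w = w' \<or> carry w w' \<or> carry w' w \<Longrightarrow> binval w = binval w'" by metis
qed

lemma binval_surj:
  assumes "0 \<le> r" "r < 1"
  obtains w where "binval w = r"
proof -
  \<comment> \<open>Binary digits as parities of floors: \<open>w k\<close> is digit number
    \<open>k + 1\<close> after the binary point.\<close>
  define w where "w k = odd \<lfloor>2 ^ Suc k * r\<rfloor>" for k
  \<comment> \<open>The first \<open>n\<close> digits give \<open>r\<close> rounded down to a
    multiple of \<open>(1 / 2) ^ n\<close>; the base case is where \<open>0 \<le> r\<close> and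
    \<open>r < 1\<close> enter.\<close>
  have partial: "(\<Sum>k<n. of_bool (w k) * (1 / 2 :: real) ^ Suc k) = \<lfloor>2 ^ n * r\<rfloor> / 2 ^ n" for n
  proof (induction n)
    case 0
    have "\<lfloor>r\<rfloor> = 0" using assms by (simp add: floor_eq_iff)
    then show ?case by simp
  next
    case (Suc n)
    have "\<lfloor>2 ^ n * r\<rfloor> = \<lfloor>2 ^ Suc n * r\<rfloor> div 2"
      using floor_divide_real_eq_div[of 2 "2 ^ Suc n * r"] by simp
    moreover have "\<lfloor>2 ^ Suc n * r\<rfloor> = 2 * (\<lfloor>2 ^ Suc n * r\<rfloor> div 2) + of_bool (w n)"
      unfolding w_def using mult_div_mod_eq[of 2 "\<lfloor>2 ^ Suc n * r\<rfloor>"]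
      by (simp add: mod_2_eq_odd)
    ultimately have "real_of_int \<lfloor>2 ^ Suc n * r\<rfloor> = 2 * real_of_int \<lfloor>2 ^ n * r\<rfloor> + of_bool (w n)"
      by (metis of_int_add of_int_mult of_int_numeral of_int_of_bool)
    then show ?case using Suc.IH by (simp add: field_simps)
  qed
  \<comment> \<open>Truncating \<open>r\<close> and dropping the digits of \<open>w\<close> from
    \<open>n\<close> on each cost at most \<open>(1 / 2) ^ n\<close>.\<close>
  have "\<bar>binval w - r\<bar> \<le> 2 * (1 / 2) ^ n" for n
  proof -
    have "\<bar>2 ^ n * r - \<lfloor>2 ^ n * r\<rfloor>\<bar> / 2 ^ n \<le> 1 / 2 ^ n"
      by (intro divide_right_mono) (linarith, simp)
    also have "\<bar>2 ^ n * r - \<lfloor>2 ^ n * r\<rfloor>\<bar> / 2 ^ n = \<bar>(2 ^ n * r - \<lfloor>2 ^ n * r\<rfloor>) / 2 ^ n\<bar>"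
      by (simp add: abs_divide)
    finally have "\<bar>r - \<lfloor>2 ^ n * r\<rfloor> / 2 ^ n\<bar> \<le> (1 / 2) ^ n"
      by (simp add: diff_divide_distrib power_one_over)
    moreover have "\<bar>(1 / 2) ^ n * binval (\<lambda>k. w (k + n))\<bar> \<le> (1 / 2) ^ n"
      using binval_nonneg binval_le_1 by (simp add: abs_mult mult_le_one)
    ultimately show ?thesis
      using binval_split[of w n] partial[of n] by linarith
  qed
  moreover have "(\<lambda>n. 2 * (1 / 2 :: real) ^ n) \<longlonglongrightarrow> 2 * 0"
    by (intro tendsto_mult tendsto_const LIMSEQ_realpow_zero) auto
  ultimately have "\<bar>binval w - r\<bar> \<le> 2 * 0"
    using LIMSEQ_le_const by blast
  then show ?thesis using that by simp
qed

section \<open>The circle as an image of binary sequences\<close>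

definition circval :: "(nat \<Rightarrow> bool) \<Rightarrow> complex" where
  "circval w = cis (2 * pi * binval w)"

lemma circval_image: "range circval = sphere 0 1"
proof
  show "range circval \<subseteq> sphere 0 1" by (auto simp: circval_def)
  show "sphere 0 1 \<subseteq> range circval"
  proof
    fix z :: complex assume "z \<in> sphere 0 1"
    then have "norm z = 1" by simp
    then obtain t where t: "0 \<le> t" "t < 2 * pi" "z = Complex (cos t) (sin t)"
      by (rule complex_unimodular_polar)
    then obtain w where "binval w = t / (2 * pi)"
      using binval_surj[of "t / (2 * pi)"] by (auto simp: field_simps)
    then have "circval w = z" using t(3) by (simp add: circval_def cis.code)
    then show "z \<in> range circval" by blast
  qed
qed

text \<open>Equal points mean that the values of \<open>binval\<close> differ by an integer. Both
  lie in the unit interval, so a nonzero difference is 1 or -1 and pairs the value 1 with the value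
  0, that is, all ones with all zeros.\<close>

lemma circval_eq_iff:
  "circval w = circval w' \<longleftrightarrow>
     w = w' \<or> carry w w' \<or> carry w' w \<or> (\<forall>k. w k \<and> \<not> w' k) \<or> (\<forall>k. w' k \<and> \<not> w k)"
proof -
  have bounds: "0 \<le> binval w" "binval w \<le> 1" "0 \<le> binval w'" "binval w' \<le> 1"
    by (rule binval_nonneg binval_le_1)+
  have "circval w = circval w' \<longleftrightarrow> (\<exists>n::int. 2 * pi * binval w = 2 * pi * binval w' + 2 * pi * n)"
    unfolding circval_def sin_cos_eq_iff[symmetric] by (auto simp: cis.code)
  also have "\<dots> \<longleftrightarrow> (\<exists>n::int. binval w = binval w' + n)"
    by (simp add: distrib_left[symmetric] mult.assoc)
  also have "\<dots> \<longleftrightarrow> binval w = binval w' \<or> binval w = 1 \<and> binval w' = 0 \<or> binval w' = 1 \<and> binval w = 0"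
  proof
    assume "\<exists>n::int. binval w = binval w' + n"
    then obtain n :: int where n: "binval w = binval w' + n" ..
    then have "- 1 \<le> real_of_int n" "real_of_int n \<le> 1" using bounds by linarith+
    then have "n = -1 \<or> n = 0 \<or> n = 1" by linarith
    then show "binval w = binval w' \<or> binval w = 1 \<and> binval w' = 0 \<or> binval w' = 1 \<and> binval w = 0"
      using n bounds by auto
  next
    assume "binval w = binval w' \<or> binval w = 1 \<and> binval w' = 0 \<or> binval w' = 1 \<and> binval w = 0"
    then show "\<exists>n::int. binval w = binval w' + n"
      by (elim disjE) (auto intro: exI[of _ 0] exI[of _ 1] exI[of _ "-1"])
  qed
  finally show ?thesis
    unfolding binval_eq_iff binval_eq_0_iff binval_eq_1_iff by auto
qed

subsection \<open>Quotients and path spaces\<close>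

text \<open>Points identified by \<open>f\<close> are identified by \<open>h\<close>, so
  \<open>h\<close> factors as \<open>g \<circ> f\<close>, and \<open>g\<close> is a quotient map
  because the composite is one. The reverse implication makes \<open>g\<close> injective, and an
  injective quotient map is a homeomorphism.\<close>

lemma homeomorphic_space_quotients_same_fibres:
  assumes f: "quotient_map X Y f" and h: "quotient_map X Z h"
    and eq: "\<And>x y. \<lbrakk>x \<in> topspace X; y \<in> topspace X\<rbrakk> \<Longrightarrow> f x = f y \<longleftrightarrow> h x = h y"
  shows "Y homeomorphic_space Z"
proof -
  have contf: "continuous_map X Y f" and conth: "continuous_map X Z h"
    using f h by (simp_all add: quotient_imp_continuous_map)
  obtain g where g: "continuous_map Y Z g" "\<And>x. x \<in> topspace X \<Longrightarrow> g (f x) = h x"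
    using quotient_map_lift_exists[OF f conth] eq by metis
  have "quotient_map X Z (g \<circ> f)"
    using h g(2) quotient_map_eq[of X Z h "g \<circ> f"] by simp
  then have "quotient_map Y Z g"
    by (rule quotient_map_from_composition[OF contf g(1)])
  moreover have "inj_on g (topspace Y)"
    unfolding quotient_imp_surjective_map[OF f, symmetric]
    by (intro inj_onI) (auto simp: g(2) eq)
  ultimately show ?thesis
    unfolding homeomorphic_space using homeomorphic_map_def by blast
qed

lemma saturated_preimage:
  assumes "equiv (topspace X) R" "S \<subseteq> topspace X" "\<And>x x'. \<lbrakk>x \<in> S; (x, x') \<in> R\<rbrakk> \<Longrightarrow> x' \<in> S"
  shows "{x \<in> topspace X. R `` {x} \<in> (\<lambda>x. R `` {x}) ` S} = S"
proof
  show "{x \<in> topspace X. R `` {x} \<in> (\<lambda>x. R `` {x}) ` S} \<subseteq> S"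
    using assms(3) eq_equiv_class[OF _ assms(1)] by (fastforce simp: assms(1))
qed (use assms(2) in auto)

lemma openin_quotient_image:
  assumes "equiv (topspace X) R" "openin X S" "\<And>x x'. \<lbrakk>x \<in> S; (x, x') \<in> R\<rbrakk> \<Longrightarrow> x' \<in> S"
  shows "openin (quotient_topology X R) ((\<lambda>x. R `` {x}) ` S)"
  using saturated_preimage[OF assms(1) openin_subset[OF assms(2)]] assms(2,3)
    openin_subset[OF assms(2)]
  by (auto simp: openin_quotient_topology quotientI)

lemma closedin_quotient_image:
  assumes "equiv (topspace X) R" "closedin X S" "\<And>x x'. \<lbrakk>x \<in> S; (x, x') \<in> R\<rbrakk> \<Longrightarrow> x' \<in> S"
  shows "closedin (quotient_topology X R) ((\<lambda>x. R `` {x}) ` S)"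
proof -
  have "(\<lambda>x. R `` {x}) ` S \<subseteq> topspace X // R"
    using closedin_subset[OF assms(2)] by (auto simp: quotientI)
  moreover have "{x \<in> topspace X. R `` {x} \<in> (\<lambda>x. R `` {x}) ` S} = S"
    using assms by (intro saturated_preimage closedin_subset)
  ultimately show ?thesis
    using quotient_map_quotient_topology[of X R, unfolded quotient_map_closedin, THEN conjunct2,
        rule_format, of "(\<lambda>x. R `` {x}) ` S"] assms(2) by simp
qed

section \<open>Cylinder sets and continuity for path spaces\<close>

lemma agree_of_path_dist_less:
  assumes "path_dist x y < (1 / 2) ^ n" "k < n"
  shows "x k = y k"
proof (rule ccontr)
  assume "x k \<noteq> y k"
  then have "(1 / 2) ^ k \<le> path_dist x y" by (rule path_dist_ge)
  moreover have "(1 / 2 :: real) ^ n \<le> (1 / 2) ^ k"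
    using assms(2) by (intro power_decreasing) auto
  ultimately show False using assms(1) by linarith
qed

text \<open>Membership is decided by the first \<open>n\<close> edges, and all points of a ball of
  radius \<open>(1 / 2) ^ n\<close> share these with the centre. The complement is of the same kind,
  so such sets are clopen.\<close>

lemma openin_path_topology_cylinder:
  assumes "S \<subseteq> path_space G"
    and "\<And>x x'. \<lbrakk>x \<in> S; x' \<in> path_space G; \<forall>k<n. x k = x' k\<rbrakk> \<Longrightarrow> x' \<in> S"
  shows "openin (path_topology G) S"
proof -
  interpret Metric_space "path_space G" path_dist by (rule Metric_space_path_dist)
  have "\<exists>r>0. mball x r \<subseteq> S" if "x \<in> S" for x
    using that assms(2)[OF that] agree_of_path_dist_less[where n = n and x = x]
    by (intro exI[of _ "(1 / 2) ^ n"]) (auto simp: in_mball)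
  then show ?thesis
    unfolding path_topology_def openin_mtopology using assms(1) by blast
qed

lemma closedin_path_topology_cylinder:
  assumes "S \<subseteq> path_space G"
    and "\<And>x x'. \<lbrakk>x \<in> S; x' \<in> path_space G; \<forall>k<n. x k = x' k\<rbrakk> \<Longrightarrow> x' \<in> S"
  shows "closedin (path_topology G) S"
proof -
  have "openin (path_topology G) (path_space G - S)"
  proof (rule openin_path_topology_cylinder[of _ _ n])
    fix x x' assume "x \<in> path_space G - S" "x' \<in> path_space G" "\<forall>k<n. x k = x' k"
    then show "x' \<in> path_space G - S" using assms(2)[of x' x] by auto
  qed simp
  then show ?thesis using assms(1) by (simp add: closedin_def)
qed

text \<open>The offset \<open>N\<close> serves functions that read a sequence only from position
  \<open>N\<close> on, where agreement on \<open>N + n\<close> edges yields \<open>n\<close> common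
  digits.\<close>

lemma continuous_map_path_topology_real:
  fixes f :: "(nat \<Rightarrow> 'e) \<Rightarrow> real"
  assumes "\<And>n x x'. (\<forall>k<N + n. x k = x' k) \<Longrightarrow> \<bar>f x - f x'\<bar> \<le> (1 / 2) ^ n"
  shows "continuous_map (path_topology G) euclideanreal f"
proof -
  interpret Metric_space "path_space G" path_dist by (rule Metric_space_path_dist)
  have "\<exists>r>0. \<forall>x. x \<in> path_space G \<and> path_dist a x < r \<longrightarrow> f x \<in> U" if U: "open U" "f a \<in> U" for a U
  proof -
    obtain e where e: "e > 0" "\<And>z. dist z (f a) < e \<Longrightarrow> z \<in> U"
      using U unfolding open_dist by metis
    obtain n where n: "(1 / 2 :: real) ^ n < e"
      using real_arch_pow_inv[of e "1 / 2"] e(1) by auto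
    have "f x \<in> U" if "path_dist a x < (1 / 2) ^ (N + n)" for x
    proof -
      have "\<bar>f a - f x\<bar> \<le> (1 / 2) ^ n"
        using agree_of_path_dist_less[OF that] by (intro assms) blast
      then show ?thesis using n e(2)[of "f x"] by (simp add: dist_real_def abs_minus_commute)
    qed
    then show ?thesis by (intro exI[of _ "(1 / 2) ^ (N + n)"]) auto
  qed
  then show ?thesis
    unfolding path_topology_def continuous_map_from_metric by auto
qed

abbreviation cantor_space :: "(nat \<Rightarrow> bool) topology" where
  "cantor_space \<equiv> product_topology (\<lambda>_. discrete_topology UNIV) UNIV"

lemma compact_cantor_space: "compact_space cantor_space"
  by (simp add: compact_space_product_topology compact_space_discrete_topology)

lemma continuous_map_cantor_path_topology:
  assumes "range f \<subseteq> path_space G"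
    and "\<And>n w w'. \<forall>k<n. w k = w' k \<Longrightarrow> \<forall>k<n. f w k = f w' k"
  shows "continuous_map cantor_space (path_topology G) f"
proof -
  interpret Metric_space "path_space G" path_dist by (rule Metric_space_path_dist)
  have "\<exists>U. openin cantor_space U \<and> w \<in> U \<and> (\<forall>v\<in>U. f v \<in> mball (f w) e)"
    if e: "e > 0" for w and e :: real
  proof -
    obtain n where n: "(1 / 2 :: real) ^ n < e"
      using real_arch_pow_inv[of e "1 / 2"] e by auto
    \<comment> \<open>The sequences sharing their first \<open>n\<close> bits with \<open>w\<close>:
      only finitely many factors are restricted, so the set is open.\<close>
    let ?U = "\<Pi>\<^sub>E k\<in>UNIV. if k < n then {w k} else UNIV"
    have "finite {k. (if k < n then {w k} else UNIV) \<noteq> (UNIV :: bool set)}"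
      by (rule finite_subset[of _ "{..<n}"]) auto
    then have "openin cantor_space ?U"
      by (intro product_topology_basis) auto
    moreover have "f v \<in> mball (f w) e" if "v \<in> ?U" for v
    proof -
      have "\<forall>k<n. w k = v k" using that by (auto simp: PiE_iff split: if_splits)
      then have "path_dist (f w) (f v) \<le> (1 / 2) ^ n"
        by (intro path_dist_le assms(2))
      then show ?thesis using n assms(1) by (auto simp: in_mball)
    qed
    ultimately show ?thesis by (intro exI[of _ ?U]) auto
  qed
  then show ?thesis
    unfolding path_topology_def continuous_map_to_metric by blast
qed

subsection \<open>Components of the glued path space\<close>

text \<open>The embeddings enter through their action on edges: agreement on vertices becomes common
  ends of \<open>emap \<xi>0 y\<close> and \<open>emap \<xi>1 y\<close>, which lets the two be
  exchanged inside any path.\<close>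

locale xi_gluing =
  fixes G :: "('a, 'b) pre_digraph" and H :: "('v, 'e) pre_digraph"
    and \<xi>0 \<xi>1 :: "('v, 'e, 'a, 'b) graph_map"
  assumes inj0: "inj_on (emap \<xi>0) (arcs H)" and inj1: "inj_on (emap \<xi>1) (arcs H)"
    and disjoint: "emap \<xi>0 ` arcs H \<inter> emap \<xi>1 ` arcs H = {}"
    and arcs0: "y \<in> arcs H \<Longrightarrow> emap \<xi>0 y \<in> arcs G"
    and arcs1: "y \<in> arcs H \<Longrightarrow> emap \<xi>1 y \<in> arcs G"
    and tail_eq: "y \<in> arcs H \<Longrightarrow> tail G (emap \<xi>0 y) = tail G (emap \<xi>1 y)"
    and head_eq: "y \<in> arcs H \<Longrightarrow> head G (emap \<xi>0 y) = head G (emap \<xi>1 y)"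
begin

abbreviation xi_arcs :: "'b set" where
  "xi_arcs \<equiv> emap \<xi>0 ` arcs H \<union> emap \<xi>1 ` arcs H"

abbreviation X :: "(nat \<Rightarrow> 'b) topology" where
  "X \<equiv> path_topology G"

abbreviation R :: "((nat \<Rightarrow> 'b) \<times> (nat \<Rightarrow> 'b)) set" where
  "R \<equiv> xi_rel G H \<xi>0 \<xi>1"

abbreviation cls :: "(nat \<Rightarrow> 'b) \<Rightarrow> (nat \<Rightarrow> 'b) set" where
  "cls x \<equiv> R `` {x}"

abbreviation Y :: "(nat \<Rightarrow> 'b) set topology" where
  "Y \<equiv> xi_space G H \<xi>0 \<xi>1"

lemma equiv_R: "equiv (topspace X) R"
  using equiv_xi_rel[OF inj0 inj1 disjoint] by simp

section \<open>Partner edges and frozen prefixes\<close>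

definition partner :: "'b \<Rightarrow> 'b \<Rightarrow> bool" where
  "partner e f \<longleftrightarrow> e = f \<or> (\<exists>y\<in>arcs H. {e, f} \<subseteq> {emap \<xi>0 y, emap \<xi>1 y})"

lemma partner_refl [simp]: "partner e e"
  by (simp add: partner_def)

text \<open>Injectivity settles the case of the same embedding, disjointness excludes the mixed one.
  Hence the partner classes inside \<open>xi_arcs\<close> are the pairs over a single
  \<open>y\<close>.\<close>

lemma xi_arc_cases:
  assumes "y \<in> arcs H" "z \<in> arcs H" "e \<in> {emap \<xi>0 y, emap \<xi>1 y}" "e \<in> {emap \<xi>0 z, emap \<xi>1 z}"
  shows "y = z"
  using assms inj0 inj1 disjoint by (auto dest: inj_onD)

lemma partner_xi:
  assumes "y \<in> arcs H" "e \<in> {emap \<xi>0 y, emap \<xi>1 y}"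
  shows "partner e f \<longleftrightarrow> f \<in> {emap \<xi>0 y, emap \<xi>1 y}"
  using assms xi_arc_cases[OF assms(1) _ assms(2)] unfolding partner_def by blast

lemma partner_trans: "partner e f \<Longrightarrow> partner f g \<Longrightarrow> partner e g"
  using partner_xi unfolding partner_def by (metis insert_subset)

lemma xi_rel_iff:
  "(x, x') \<in> R \<longleftrightarrow> x \<in> path_space G \<and> x' \<in> path_space G \<and>
     (x = x' \<or> glue1 H \<xi>0 \<xi>1 x x' \<or> glue2 H \<xi>0 \<xi>1 x x' \<or> glue1 H \<xi>0 \<xi>1 x' x \<or> glue2 H \<xi>0 \<xi>1 x' x)"
  unfolding xi_rel_def using glue1_sym glue2_sym by fastforce

text \<open>Both clauses share one shape: a common prefix, then at every position two edges over the
  same \<open>y\<close>. Which of them comes from \<open>\<xi>0\<close> is forgotten here.\<close>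

lemma glue_differ:
  assumes "glue1 H \<xi>0 \<xi>1 x x' \<or> glue2 H \<xi>0 \<xi>1 x x'"
  obtains m where "\<forall>k<m. x k = x' k"
    and "\<forall>k\<ge>m. \<exists>y\<in>arcs H. {x k, x' k} \<subseteq> {emap \<xi>0 y, emap \<xi>1 y}"
  using assms
proof
  assume "glue1 H \<xi>0 \<xi>1 x x'"
  then obtain m y where *: "\<forall>k<m. x k = x' k" "\<forall>k\<ge>m. y k \<in> arcs H"
    "x m = emap \<xi>1 (y m)" "x' m = emap \<xi>0 (y m)"
    "\<forall>k>m. x k = emap \<xi>0 (y k) \<and> x' k = emap \<xi>1 (y k)"
    unfolding glue1_def by (elim exE conjE)
  then have "\<forall>k\<ge>m. \<exists>y\<in>arcs H. {x k, x' k} \<subseteq> {emap \<xi>0 y, emap \<xi>1 y}"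
    by (metis insertI1 insertI2 empty_subsetI insert_subset le_neq_implies_less)
  then show ?thesis using that *(1) by blast
next
  assume "glue2 H \<xi>0 \<xi>1 x x'"
  then show ?thesis using that unfolding glue2_def by (metis insertI1 insertI2 empty_subsetI insert_subset)
qed

lemma xi_rel_differ:
  assumes "(x, x') \<in> R"
  obtains "x = x'" | m where "\<forall>k<m. x k = x' k"
    and "\<forall>k\<ge>m. \<exists>y\<in>arcs H. {x k, x' k} \<subseteq> {emap \<xi>0 y, emap \<xi>1 y}"
proof -
  consider "x = x'" | "glue1 H \<xi>0 \<xi>1 x x' \<or> glue2 H \<xi>0 \<xi>1 x x'" | "glue1 H \<xi>0 \<xi>1 x' x \<or> glue2 H \<xi>0 \<xi>1 x' x"
    using assms unfolding xi_rel_iff by blast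
  then show ?thesis
  proof cases
    case 2
    then show ?thesis using glue_differ that(2) by blast
  next
    case 3
    then obtain m where "\<forall>k<m. x' k = x k"
      and "\<forall>k\<ge>m. \<exists>y\<in>arcs H. {x' k, x k} \<subseteq> {emap \<xi>0 y, emap \<xi>1 y}"
      by (rule glue_differ)
    then show ?thesis using that(2)[of m] by (simp add: insert_commute)
  qed (rule that(1))
qed

lemma xi_rel_partner:
  assumes "(x, x') \<in> R"
  shows "partner (x k) (x' k)"
  using assms
proof (cases rule: xi_rel_differ)
  case (2 m)
  then show ?thesis unfolding partner_def by (cases "k < m") (auto simp: not_less)
qed simp

text \<open>Beyond the common prefix both sequences stay in \<open>xi_arcs\<close>, so a position
  with an edge outside \<open>xi_arcs\<close> still belongs to the common prefix.\<close>

lemma xi_rel_prefix: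
  assumes "(x, x') \<in> R" "x k \<notin> xi_arcs" "j \<le> k"
  shows "x j = x' j"
  using assms(1)
proof (cases rule: xi_rel_differ)
  case (2 m)
  have "k < m"
    using 2(2)[rule_format, of k] assms(2) by (auto simp: not_less[symmetric])
  then show ?thesis using 2(1) assms(3) by simp
qed simp

section \<open>Stages, strands and components\<close>

definition stage :: "(nat \<Rightarrow> 'b) \<Rightarrow> nat \<Rightarrow> (nat \<Rightarrow> 'b) set" where
  "stage x n = {x' \<in> path_space G. \<forall>k<n. partner (x k) (x' k) \<and>
     (x k \<notin> xi_arcs \<longrightarrow> (\<forall>j\<le>k. x' j = x j))}"

definition strand :: "(nat \<Rightarrow> 'b) \<Rightarrow> (nat \<Rightarrow> 'b) set" where
  "strand x = (\<Inter>n. stage x n)"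

lemma mem_strand_iff:
  "x' \<in> strand x \<longleftrightarrow> x' \<in> path_space G \<and>
     (\<forall>k. partner (x k) (x' k) \<and> (x k \<notin> xi_arcs \<longrightarrow> (\<forall>j\<le>k. x' j = x j)))"
  unfolding strand_def stage_def by (auto intro: lessI)

lemma strand_self: "x \<in> path_space G \<Longrightarrow> x \<in> strand x"
  by (simp add: mem_strand_iff)

lemma stage_saturated:
  assumes "x' \<in> stage x n" "(x', x'') \<in> R"
  shows "x'' \<in> stage x n"
proof -
  have "partner (x k) (x'' k)" if "k < n" for k
    using assms that xi_rel_partner[OF assms(2)] partner_trans unfolding stage_def by blast
  moreover have "x'' j = x j" if "k < n" "x k \<notin> xi_arcs" "j \<le> k" for j k
  proof -
    \<comment> \<open>In particular \<open>x' k = x k\<close> is outside \<open>xi_arcs\<close>, so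
      position \<open>k\<close> is frozen in \<open>x'\<close> as well.\<close>
    have "\<forall>i\<le>k. x' i = x i" using assms(1) that unfolding stage_def by blast
    then show ?thesis using xi_rel_prefix[OF assms(2), of k j] that by simp
  qed
  ultimately show ?thesis
    using assms(2) unfolding stage_def xi_rel_iff by blast
qed

lemma strand_saturated:
  assumes "x' \<in> strand x" "(x', x'') \<in> R"
  shows "x'' \<in> strand x"
  using assms stage_saturated unfolding strand_def by blast

lemma stage_cylinder:
  assumes "x' \<in> stage x n" "x'' \<in> path_space G" "\<forall>k<n. x' k = x'' k"
  shows "x'' \<in> stage x n"
proof -
  have "partner (x k) (x'' k) \<and> (x k \<notin> xi_arcs \<longrightarrow> (\<forall>j\<le>k. x'' j = x j))" if "k < n" for k
  proof -
    have "\<forall>j\<le>k. x'' j = x' j" using assms(3) that by simp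
    then show ?thesis using assms(1) that unfolding stage_def by auto
  qed
  then show ?thesis using assms(2) unfolding stage_def by blast
qed

lemma openin_stage: "openin X (stage x n)"
  by (rule openin_path_topology_cylinder[OF _ stage_cylinder]) (auto simp: stage_def)

lemma closedin_stage: "closedin X (stage x n)"
  by (rule closedin_path_topology_cylinder[OF _ stage_cylinder]) (auto simp: stage_def)

lemma closedin_strand: "closedin X (strand x)"
  unfolding strand_def using closedin_stage by (intro closedin_Inter) auto

text \<open>Stages are clopen and saturated, so their images are clopen; a component that meets such
  an image, as it does in \<open>cls x\<close>, lies inside it.\<close>

lemma component_subset_strand:
  assumes "x \<in> path_space G"
  shows "connected_component_of_set Y (cls x) \<subseteq> cls ` strand x"
proof
  fix p assume p: "p \<in> connected_component_of_set Y (cls x)"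
  have "p \<in> topspace Y"
    using subsetD[OF connected_component_of_subset_topspace p] .
  then obtain x' where x': "x' \<in> path_space G" "p = cls x'"
    by (auto simp: xi_space_def elim: quotientE)
  have "x' \<in> stage x n" for n
  proof -
    have "openin Y (cls ` stage x n)" "closedin Y (cls ` stage x n)"
      unfolding xi_space_def
      by (rule openin_quotient_image closedin_quotient_image,
          auto intro: equiv_R[simplified] openin_stage closedin_stage stage_saturated)+
    then have "connected_component_of_set Y (cls x) \<subseteq> cls ` stage x n \<or>
        disjnt (connected_component_of_set Y (cls x)) (cls ` stage x n)"
      using connectedin_clopen_cases[OF connectedin_connected_component_of] by metis
    moreover have "cls x \<in> connected_component_of_set Y (cls x)"
      using assms by (simp add: connected_component_of_refl xi_space_def quotientI)
    moreover have "cls x \<in> cls ` stage x n"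
      using strand_self[OF assms] unfolding strand_def by blast
    ultimately have "p \<in> cls ` stage x n" using p unfolding disjnt_def by blast
    \<comment> \<open>The representative \<open>z\<close> varies with \<open>n\<close>; saturation
      moves the membership to the fixed \<open>x'\<close>, which then lies in every stage.\<close>
    then obtain z where z: "z \<in> stage x n" "cls z = cls x'" using x'(2) by auto
    then have "(z, x') \<in> R"
      using eq_equiv_class[OF z(2) equiv_R] x'(1) by simp
    then show ?thesis using stage_saturated z(1) by blast
  qed
  then show "p \<in> cls ` strand x" using x'(2) unfolding strand_def by blast
qed

lemma component_point:
  assumes "x \<in> path_space G" "\<exists>\<^sub>\<infinity>k. x k \<notin> xi_arcs"
  shows "is_point (connected_component_of_set Y (cls x))"
proof -
  have "strand x \<subseteq> {x}"
  proof
    fix x' assume "x' \<in> strand x"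
    then have "x' j = x j" for j
      using assms(2) unfolding mem_strand_iff INFM_nat_le by blast
    then show "x' \<in> {x}" by auto
  qed
  then have "connected_component_of_set Y (cls x) \<subseteq> {cls x}"
    using component_subset_strand[OF assms(1)] by blast
  moreover have "cls x \<in> connected_component_of_set Y (cls x)"
    using assms by (simp add: connected_component_of_refl xi_space_def quotientI)
  ultimately show ?thesis unfolding is_point_def by blast
qed

end

section \<open>Strands of sequences with a tail in \<open>xi_arcs\<close>\<close>

locale xi_tail = xi_gluing G H \<xi>0 \<xi>1
  for G :: "('a, 'b) pre_digraph" and H :: "('v, 'e) pre_digraph"
    and \<xi>0 \<xi>1 :: "('v, 'e, 'a, 'b) graph_map" +
  fixes x :: "nat \<Rightarrow> 'b" and N :: nat and y :: "nat \<Rightarrow> 'e"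
  assumes x_path: "x \<in> path_space G"
    and N_first: "N = 0 \<or> x (N - 1) \<notin> xi_arcs"
    and y_arcs: "k \<ge> N \<Longrightarrow> y k \<in> arcs H"
    and x_tail: "k \<ge> N \<Longrightarrow> x k \<in> {emap \<xi>0 (y k), emap \<xi>1 (y k)}"
begin

definition lift :: "(nat \<Rightarrow> bool) \<Rightarrow> nat \<Rightarrow> 'b" where
  "lift w k = (if k < N then x k else if w (k - N) then emap \<xi>1 (y k) else emap \<xi>0 (y k))"

text \<open>Inverse to \<open>lift\<close> on the strand, but defined for every sequence: an edge
  other than \<open>emap \<xi>1 (y (N + k))\<close> reads as zero, so continuity can be stated on
  all of \<open>X\<close>.\<close>

definition digits :: "(nat \<Rightarrow> 'b) \<Rightarrow> nat \<Rightarrow> bool" where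
  "digits x' k \<longleftrightarrow> x' (N + k) = emap \<xi>1 (y (N + k))"

lemma emap_neq: "u \<in> arcs H \<Longrightarrow> v \<in> arcs H \<Longrightarrow> emap \<xi>0 u \<noteq> emap \<xi>1 v"
  using disjoint by blast

lemma digits_lift [simp]: "digits (lift w) = w"
proof
  show "digits (lift w) k = w k" for k
    using emap_neq[OF y_arcs y_arcs, of "N + k" "N + k"] by (simp add: digits_def lift_def)
qed

text \<open>Lying in one image or the other already decides the bit, by disjointness;
  \<open>u\<close> is not compared with \<open>y k\<close>.\<close>

lemma lift_eq_emap1:
  assumes "k \<ge> N" "u \<in> arcs H" "lift w k = emap \<xi>1 u"
  shows "w (k - N)"
  using assms emap_neq[OF y_arcs[OF assms(1)] assms(2)] by (auto simp: lift_def split: if_splits)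

lemma lift_eq_emap0:
  assumes "k \<ge> N" "u \<in> arcs H" "lift w k = emap \<xi>0 u"
  shows "\<not> w (k - N)"
  using assms emap_neq[OF assms(2) y_arcs[OF assms(1)]] by (auto simp: lift_def split: if_splits)

lemma lift_tail: "k \<ge> N \<Longrightarrow> lift w k \<in> xi_arcs"
  using y_arcs by (simp add: lift_def)

text \<open>Exchanging the two edges over \<open>y k\<close> preserves both ends, so every choice of
  bits turns the path \<open>x\<close> into a path.\<close>

lemma lift_same_ends:
  "lift w k \<in> arcs G \<and> tail G (lift w k) = tail G (x k) \<and> head G (lift w k) = head G (x k)"
proof (cases "k < N")
  case True
  then show ?thesis using x_path by (auto simp: lift_def path_space_def)
next
  case False
  then show ?thesis
    using x_tail[of k] y_arcs[of k] arcs0 arcs1 tail_eq head_eq by (auto simp: lift_def)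
qed

lemma lift_path: "lift w \<in> path_space G"
  using lift_same_ends x_path by (auto simp: path_space_def)

lemma strand_eq_range_lift: "strand x = range lift"
proof
  show "range lift \<subseteq> strand x"
  proof
    fix x' assume "x' \<in> range lift"
    then obtain w where w: "x' = lift w" by blast
    have "partner (x k) (lift w k)" for k
      using partner_xi[OF y_arcs x_tail, of k] by (cases "k < N") (auto simp: lift_def)
    moreover have "k < N" if "x k \<notin> xi_arcs" for k
      using x_tail[of k] y_arcs[of k] that by (cases "k < N") auto
    then have "lift w j = x j" if "x k \<notin> xi_arcs" "j \<le> k" for j k
      using that le_less_trans[of j k N] by (simp add: lift_def)
    ultimately show "x' \<in> strand x"
      unfolding mem_strand_iff w using lift_path by blast
  qed
  show "strand x \<subseteq> range lift"
  proof
    fix x' assume x': "x' \<in> strand x"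
    have "x' k = lift (digits x') k" for k
    proof (cases "k < N")
      case True
      \<comment> \<open>Here \<open>N\<close> is positive, so \<open>N - 1\<close> is a frozen
        position of \<open>x\<close>, which forces the whole prefix.\<close>
      then have "x (N - 1) \<notin> xi_arcs" "k \<le> N - 1" using N_first by auto
      then have "x' k = x k" using x' unfolding mem_strand_iff by blast
      then show ?thesis using True by (simp add: lift_def)
    next
      case False
      then have "x' k \<in> {emap \<xi>0 (y k), emap \<xi>1 (y k)}"
        using x' partner_xi[OF y_arcs x_tail, of k] unfolding mem_strand_iff by auto
      then show ?thesis using False by (auto simp: lift_def digits_def)
    qed
    then have "x' = lift (digits x')" by blast
    then show "x' \<in> range lift" by blast
  qed
qed

text \<open>With 0 for \<open>\<xi>0\<close> and 1 for \<open>\<xi>1\<close>, clause (1) reads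
  1000... against 0111... after a common prefix.\<close>

lemma glue1_lift_iff: "glue1 H \<xi>0 \<xi>1 (lift w) (lift w') \<longleftrightarrow> carry w w'"
proof
  assume "glue1 H \<xi>0 \<xi>1 (lift w) (lift w')"
  then obtain m z where *: "\<forall>k<m. lift w k = lift w' k" "\<forall>k\<ge>m. z k \<in> arcs H"
    "lift w m = emap \<xi>1 (z m)" "lift w' m = emap \<xi>0 (z m)"
    "\<forall>k>m. lift w k = emap \<xi>0 (z k) \<and> lift w' k = emap \<xi>1 (z k)"
    unfolding glue1_def by (elim exE conjE)
  \<comment> \<open>Before \<open>N\<close> the two lifts coincide, while at \<open>m\<close> they
    lie in disjoint images.\<close>
  have "N \<le> m"
    using *(2,3,4) emap_neq[of "z m" "z m"] by (auto simp: lift_def split: if_splits)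
  have "w k = w' k" if "k < m - N" for k
  proof -
    have "lift w (N + k) = lift w' (N + k)" using *(1) that by simp
    then have "digits (lift w) k = digits (lift w') k" unfolding digits_def by (rule arg_cong)
    then show ?thesis by simp
  qed
  moreover have "w (m - N)" "\<not> w' (m - N)"
    using *(2,3,4) \<open>N \<le> m\<close> lift_eq_emap1[of m "z m" w] lift_eq_emap0[of m "z m" w'] by auto
  moreover have "\<not> w k \<and> w' k" if "k > m - N" for k
  proof -
    have "N + k > m" using that by simp
    then show ?thesis
      using *(2,5) lift_eq_emap1[of "N + k" "z (N + k)" w'] lift_eq_emap0[of "N + k" "z (N + k)" w]
      by simp
  qed
  ultimately show "carry w w'"
    unfolding carry_def by (intro exI[of _ "m - N"]) simp
next
  assume "carry w w'"
  then obtain m where m: "\<forall>k<m. w k = w' k" "w m" "\<not> w' m" "\<forall>k>m. \<not> w k \<and> w' k"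
    unfolding carry_def by blast
  then show "glue1 H \<xi>0 \<xi>1 (lift w) (lift w')"
    unfolding glue1_def using y_arcs
    by (intro exI[of _ "N + m"] exI[of _ y]) (auto simp: lift_def)
qed

lemma glue2_lift_iff: "glue2 H \<xi>0 \<xi>1 (lift w) (lift w') \<longleftrightarrow> (\<forall>k. w' k \<and> \<not> w k)"
proof
  assume "glue2 H \<xi>0 \<xi>1 (lift w) (lift w')"
  then obtain n z where n: "n = 0 \<or> lift w (n - 1) \<notin> xi_arcs"
    and eq: "\<forall>k<n. lift w k = lift w' k"
    and z: "\<forall>k\<ge>n. z k \<in> arcs H \<and> lift w k = emap \<xi>0 (z k) \<and> lift w' k = emap \<xi>1 (z k)"
    unfolding glue2_def by (elim exE conjE)
  \<comment> \<open>From \<open>N\<close> on every edge is in \<open>xi_arcs\<close>, so the side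
    condition on the edge before \<open>n\<close> rules out \<open>n > N\<close>. The inequality
    suffices, since the digits begin at \<open>N\<close>.\<close>
  have "n \<le> N"
  proof (rule ccontr)
    assume "\<not> n \<le> N"
    then have "n \<noteq> 0" "N \<le> n - 1" by auto
    then show False using n lift_tail[of "n - 1" w] by blast
  qed
  show "\<forall>k. w' k \<and> \<not> w k"
  proof
    fix k
    have "N + k \<ge> n" using \<open>n \<le> N\<close> by simp
    then show "w' k \<and> \<not> w k"
      using z lift_eq_emap1[of "N + k" "z (N + k)" w'] lift_eq_emap0[of "N + k" "z (N + k)" w] by simp
  qed
next
  assume "\<forall>k. w' k \<and> \<not> w k"
  \<comment> \<open>For the witness \<open>N\<close>, the side condition of clause (2) is
    \<open>N_first\<close>.\<close>
  then show "glue2 H \<xi>0 \<xi>1 (lift w) (lift w')"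
    unfolding glue2_def using y_arcs N_first
    by (intro exI[of _ N] exI[of _ y]) (auto simp: lift_def)
qed

text \<open>The alternatives of \<open>xi_rel_iff\<close> correspond one by one to those of
  \<open>circval_eq_iff\<close>.\<close>

lemma xi_rel_lift_iff: "(lift w, lift w') \<in> R \<longleftrightarrow> circval w = circval w'"
proof -
  have "lift w = lift w' \<longleftrightarrow> w = w'" using digits_lift by metis
  then show ?thesis
    unfolding xi_rel_iff circval_eq_iff glue1_lift_iff glue2_lift_iff using lift_path by auto
qed

lemma continuous_map_lift: "continuous_map cantor_space (subtopology X (strand x)) lift"
proof -
  have "continuous_map cantor_space X lift"
    by (rule continuous_map_cantor_path_topology) (auto simp: lift_path lift_def)
  then show ?thesis by (simp add: continuous_map_in_subtopology strand_eq_range_lift)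
qed

lemma continuous_map_circval_digits: "continuous_map X (top_of_set (sphere 0 1)) (circval \<circ> digits)"
proof -
  have "continuous_map X euclideanreal (binval \<circ> digits)"
    by (rule continuous_map_path_topology_real[where N = N]) (auto intro: binval_dist_le simp: digits_def)
  moreover have "continuous_map euclideanreal euclidean (\<lambda>r. cis (2 * pi * r))"
    by (simp add: cis_conv_exp) (intro continuous_intros)
  ultimately have "continuous_map X euclidean ((\<lambda>r. cis (2 * pi * r)) \<circ> (binval \<circ> digits))"
    by (rule continuous_map_compose)
  then have "continuous_map X euclidean (circval \<circ> digits)"
    by (simp add: comp_def circval_def)
  then show ?thesis using circval_image by (auto simp: continuous_map_in_subtopology)
qed

text \<open>After \<open>lift\<close> the map is \<open>circval\<close>, a continuous surjection
  from a compact space onto a Hausdorff space, hence closed and a quotient map. If a composite of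
  continuous maps is a quotient map, so is its outer factor.\<close>

lemma quotient_map_circval_digits:
  "quotient_map (subtopology X (strand x)) (top_of_set (sphere 0 1)) (circval \<circ> digits)"
proof (rule quotient_map_from_composition[OF continuous_map_lift])
  show cont: "continuous_map (subtopology X (strand x)) (top_of_set (sphere 0 1)) (circval \<circ> digits)"
    by (rule continuous_map_from_subtopology[OF continuous_map_circval_digits])
  have cont': "continuous_map cantor_space (top_of_set (sphere 0 1)) (circval \<circ> digits \<circ> lift)"
    by (rule continuous_map_compose[OF continuous_map_lift cont])
  have "closed_map cantor_space (top_of_set (sphere 0 1)) (circval \<circ> digits \<circ> lift)"
    by (intro continuous_imp_closed_map_gen[OF compact_cantor_space _ cont'] Hausdorff_imp_kc_space
        Hausdorff_space_subtopology Hausdorff_space_euclidean)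
  then show "quotient_map cantor_space (top_of_set (sphere 0 1)) (circval \<circ> digits \<circ> lift)"
    using cont' circval_image by (intro continuous_closed_imp_quotient_map) (auto simp: comp_def)
qed

text \<open>On the strand, \<open>cls\<close> and \<open>circval \<circ> digits\<close> are quotient
  maps with the same fibres by \<open>xi_rel_lift_iff\<close>; for \<open>cls\<close> this uses that
  the strand is closed and saturated.\<close>

lemma homeomorphic_circle: "is_circle Y (cls ` strand x)"
  unfolding is_circle_def
proof (rule homeomorphic_space_quotients_same_fibres[OF _ quotient_map_circval_digits])
  have "closedin Y (cls ` strand x)"
    unfolding xi_space_def using strand_saturated
    by (intro closedin_quotient_image equiv_R closedin_strand)
  then show "quotient_map (subtopology X (strand x)) (subtopology Y (cls ` strand x)) cls"
    unfolding xi_space_def using strand_saturated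
    by (intro quotient_map_restriction quotient_map_quotient_topology disjI2
        saturated_preimage equiv_R closedin_subset closedin_strand)
  fix u v assume "u \<in> topspace (subtopology X (strand x))" "v \<in> topspace (subtopology X (strand x))"
  then obtain w w' where w: "u = lift w" "v = lift w'"
    using strand_eq_range_lift by auto
  have "cls u = cls v \<longleftrightarrow> (u, v) \<in> R"
    using eq_equiv_class_iff[OF equiv_R] lift_path w by simp
  then show "cls u = cls v \<longleftrightarrow> (circval \<circ> digits) u = (circval \<circ> digits) v"
    using xi_rel_lift_iff w by simp
qed

text \<open>The image of the strand is connected, being a circle, and contains \<open>cls x\<close>;
  this gives the inclusion converse to \<open>component_subset_strand\<close>.\<close>

lemma component_circle: "is_circle Y (connected_component_of_set Y (cls x))"
proof -
  have "connected_space (top_of_set (sphere (0 :: complex) 1))"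
    by (simp add: connected_space_subtopology connectedin_iff_connected connected_sphere)
  then have "connected_space (subtopology Y (cls ` strand x))"
    using homeomorphic_circle homeomorphic_connected_space unfolding is_circle_def by blast
  moreover have "cls ` strand x \<subseteq> topspace Y"
    by (auto simp: xi_space_def mem_strand_iff quotientI)
  ultimately have "connectedin Y (cls ` strand x)"
    by (simp add: connectedin_def)
  then have "cls ` strand x \<subseteq> connected_component_of_set Y (cls x)"
    using strand_self[OF x_path] by (intro connected_component_of_maximal) auto
  then show ?thesis
    using component_subset_strand[OF x_path] homeomorphic_circle by (simp add: subset_antisym)
qed

end

section \<open>The dichotomy of tails and the existence of both kinds of components\<close>

context xi_gluing
begin

lemma component_circle_of_tail:
  assumes "x \<in> path_space G" "\<forall>\<^sub>\<infinity>k. x k \<in> xi_arcs"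
  shows "is_circle Y (connected_component_of_set Y (cls x))"
proof -
  \<comment> \<open>Minimality puts the edge just before the tail, if there is one, outside
    \<open>xi_arcs\<close>.\<close>
  define N where "N = (LEAST N. \<forall>k\<ge>N. x k \<in> xi_arcs)"
  have tail: "\<forall>k\<ge>N. x k \<in> xi_arcs"
    unfolding N_def using assms(2) unfolding MOST_nat_le by (rule LeastI_ex)
  have first: "N = 0 \<or> x (N - 1) \<notin> xi_arcs"
  proof (rule ccontr)
    assume neg: "\<not> (N = 0 \<or> x (N - 1) \<notin> xi_arcs)"
    have "x k \<in> xi_arcs" if "k \<ge> N - 1" for k
      using neg tail that by (cases "k = N - 1") auto
    then have "N \<le> N - 1" unfolding N_def by (intro Least_le) blast
    then show False using neg by (cases N) auto
  qed
  have "\<forall>k. \<exists>u. k \<ge> N \<longrightarrow> u \<in> arcs H \<and> x k \<in> {emap \<xi>0 u, emap \<xi>1 u}"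
    using tail by blast
  then obtain y where y: "\<And>k. k \<ge> N \<Longrightarrow> y k \<in> arcs H \<and> x k \<in> {emap \<xi>0 (y k), emap \<xi>1 (y k)}"
    by metis
  interpret xi_tail G H \<xi>0 \<xi>1 x N y
    using assms(1) first y by unfold_locales auto
  show ?thesis by (rule component_circle)
qed

end

text \<open>Inside a period consecutive edges match by the walk condition; at the wrap-around the
  last edge ends at \<open>v\<close>, where the first begins.\<close>

lemma periodic_path:
  assumes "pre_digraph.awalk G v p v" "p \<noteq> []"
  shows "(\<lambda>n. p ! (n mod length p)) \<in> path_space G"
proof -
  interpret pre_digraph G .
  have step: "head G (p ! i) = (if Suc i < length p then tail G (p ! Suc i) else w)"
    if "cas u p w" "i < length p" for u p w i
    using that
  proof (induction p arbitrary: u i)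
    case (Cons e p)
    then show ?case by (cases i; cases p) auto
  qed simp
  have cas: "cas v p v" "set p \<subseteq> arcs G" using assms(1) by (auto simp: awalk_def)
  have first: "tail G (p ! 0) = v" using cas(1) assms(2) by (cases p) auto
  have "head G (p ! (n mod length p)) = tail G (p ! (Suc n mod length p))" for n
  proof -
    have "n mod length p < length p" using assms(2) by simp
    then show ?thesis
      using step[OF cas(1), of "n mod length p"] first by (auto simp: mod_Suc)
  qed
  moreover have "p ! (n mod length p) \<in> arcs G" for n
    using cas(2) assms(2) by (auto intro: nth_mem)
  ultimately show ?thesis by (simp add: path_space_def)
qed

lemma xi_space_components:
  assumes "C \<in> connected_components_of (xi_space G H \<xi>0 \<xi>1)"
  obtains x where "x \<in> path_space G"
    "C = connected_component_of_set (xi_space G H \<xi>0 \<xi>1) (xi_rel G H \<xi>0 \<xi>1 `` {x})"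
  using assms unfolding connected_components_of_def xi_space_def by (auto elim!: quotientE)

text \<open>The existence claims carry exact conditions: a null \<open>G\<close> has no infinite
  paths, and a sequence with a tail in \<open>\<xi>(H\<^sup>1)\<close> yields an infinite path in
  \<open>H\<close>, the embeddings being injective on vertices.\<close>

theorem corollary7p7:
  fixes G :: "('a, 'b) pre_digraph" and H :: "('v, 'e) pre_digraph"
    and \<xi>0 \<xi>1 :: "('v, 'e, 'a, 'b) graph_map"
  assumes "fin_digraph G" and "fin_digraph H"
    and "graph_embedding H G \<xi>0" and "graph_embedding H G \<xi>1"
    and "primitive_digraph G"
    and "\<forall>v\<in>verts H. vmap \<xi>0 v = vmap \<xi>1 v"
    and "emap \<xi>0 ` arcs H \<inter> emap \<xi>1 ` arcs H = {}"
    and "\<forall>y\<in>arcs H. \<exists>x\<in>arcs G - (emap \<xi>0 ` arcs H \<union> emap \<xi>1 ` arcs H).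
           tail G x = tail G (emap \<xi>0 y) \<and> head G x = head G (emap \<xi>0 y)"
  shows "(\<forall>C\<in>connected_components_of (xi_space G H \<xi>0 \<xi>1).
            is_point C \<or> is_circle (xi_space G H \<xi>0 \<xi>1) C) \<and>
         (verts G \<noteq> {} \<longrightarrow>
            (\<exists>C\<in>connected_components_of (xi_space G H \<xi>0 \<xi>1). is_point C)) \<and>
         (path_space H \<noteq> {} \<longrightarrow>
            (\<exists>C\<in>connected_components_of (xi_space G H \<xi>0 \<xi>1). is_circle (xi_space G H \<xi>0 \<xi>1) C))"
proof -
  interpret G: fin_digraph G by fact
  interpret H: fin_digraph H by fact
  interpret xi_gluing G H \<xi>0 \<xi>1
    using assms(3,4,6,7) by unfold_locales (auto simp: graph_embedding_def)
  have component: "connected_component_of_set Y (cls x) \<in> connected_components_of Y"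
    if "x \<in> path_space G" for x
    using that by (auto simp: connected_components_of_def xi_space_def intro!: imageI quotientI)
  \<comment> \<open>Either infinitely many edges lie outside \<open>xi_arcs\<close>, or all but
    finitely many lie inside.\<close>
  have "is_point C \<or> is_circle Y C" if "C \<in> connected_components_of Y" for C
    using xi_space_components[OF that] component_point component_circle_of_tail
    unfolding INFM_iff_infinite MOST_iff_cofinite by metis
  moreover have "\<exists>C\<in>connected_components_of Y. is_point C" if "verts G \<noteq> {}"
  proof -
    obtain K where K: "K \<ge> 1"
      "\<And>v w. \<lbrakk>v \<in> verts G; w \<in> verts G\<rbrakk> \<Longrightarrow> \<exists>p. G.awalk v p w \<and> length p = K"
      using assms(5) unfolding primitive_digraph_def by blast
    \<comment> \<open>If \<open>H\<close> has edges, the hypothesis on parallel edges supplies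
      \<open>e\<close>. Otherwise any edge of \<open>G\<close> will do, and a closed walk of length
      \<open>K \<ge> 1\<close> contains one.\<close>
    obtain e where e: "e \<in> arcs G" "e \<notin> xi_arcs"
    proof (cases "arcs H = {}")
      case True
      obtain v p where "G.awalk v p v" "length p = K" using K(2) \<open>verts G \<noteq> {}\<close> by blast
      then have "hd p \<in> arcs G"
        using K(1) hd_in_set[of p] by (cases p) (auto simp: G.awalk_def)
      then show ?thesis using that[of "hd p"] True by simp
    next
      case False
      then show ?thesis using assms(8) that(1) by blast
    qed
    \<comment> \<open>Primitivity completes \<open>e\<close> to a closed walk, whose periodic
      repetition passes through \<open>e\<close>, a frozen position, infinitely often.\<close>
    obtain p where p: "G.awalk (head G e) p (tail G e)"
      using K(2)[OF G.head_in_verts[OF e(1)] G.tail_in_verts[OF e(1)]] by blast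
    define x where "x n = (e # p) ! (n mod length (e # p))" for n
    have "x \<in> path_space G"
      unfolding x_def using p e(1) by (intro periodic_path[of _ "tail G e"]) (auto simp: G.awalk_def)
    moreover have "\<exists>\<^sub>\<infinity>k. x k \<notin> xi_arcs"
      unfolding INFM_nat_le
    proof
      fix m
      have "x (m * length (e # p)) = e" by (simp only: x_def mod_mult_self2_is_0 nth_Cons_0)
      then show "\<exists>k\<ge>m. x k \<notin> xi_arcs"
        using e(2) by (intro exI[of _ "m * length (e # p)"]) auto
    qed
    ultimately show ?thesis using component_point component by blast
  qed
  moreover have "\<exists>C\<in>connected_components_of Y. is_circle Y C" if "path_space H \<noteq> {}"
  proof -
    obtain y where y: "y \<in> path_space H" using \<open>path_space H \<noteq> {}\<close> by blast
    then have arcs: "y k \<in> arcs H" for k by (simp add: path_space_def)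
    \<comment> \<open>The image of a path of \<open>H\<close> under \<open>\<xi>0\<close> lies
      entirely in \<open>xi_arcs\<close>.\<close>
    have "(\<lambda>k. emap \<xi>0 (y k)) \<in> path_space G"
      using y assms(3) by (auto simp: path_space_def graph_embedding_def)
    then show ?thesis
      using component_circle_of_tail[of "\<lambda>k. emap \<xi>0 (y k)"] component arcs by auto
  qed
  ultimately show ?thesis by blast
qed

end
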